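(* Let $P$ be a set of $n$ different points in a metric space $(X,d)$, let $k\le n$ be a positive integer, and let (IP) and (LP) be the integer program and linear program of the $k$-median problem on $P$ given in the context. Let $(\bar y,\bar z)$ be a feasible solution to (IP). Let $a_i$, $i\in[k]$, be the $k$ points in $P$ such that $\bar y_{a_i}=1$. For every $i\in[k]$, let $A_i:=\{q\in P \mid \bar z_{a_i q}=1\}$. Then $(\bar y,\bar z)$ is optimal to (LP) if and only if there exists $\alpha\in\mathbb{R}^P$ such that \begin{align*} &\text{(i)}\quad C^\alpha(a_1)=\dots=C^\alpha(a_k),\\ &\text{(ii)}\quad C^\alpha(q)\le C^\alpha(a_1) && \forall q\in P\setminus\{a_i\}_{i\in[k]},\\ &\text{(iii)}\quad \alpha_q\ge d(a_i,q) && \forall i\in[k],\ \forall q\in A_i,\\ &\text{(iv)}\quad \alpha_q\le d(a_i,q) && \forall i\in[k],\ \forall q\in P\setminus A_i. \end{align*} Furthermore, if there exists $\alpha\in\mathbb{R}^P$ such that (i) and (iii) hold, and all the inequalities in (ii) and (iv) are satisfied strictly, then $(\bar y,\bar z)$ is the unique optimal solution to (LP).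
   Context: Notation: $[k]=\{1,\dots,k\}$ and $t_+:=\max\{t,0\}$ for a real number $t$. The integer program (IP) has variables $y_p$ ($p\in P$) and $z_{pq}$ ($p,q\in P$): \[ \min \sum_{p,q\in P} d(p,q)z_{pq}\quad\text{s.t.}\quad \sum_{p\in P}z_{pq}=1\ \forall q\in P;\quad z_{pq}\le y_p\ \forall p,q\in P;\quad \sum_{p\in P}y_p=k;\quad y_p,z_{pq}\in\{0,1\}\ \forall p,q\in P. \] The linear program (LP) is obtained from (IP) by replacing the constraints $y_p,z_{pq}\in\{0,1\}$ with $y_p,z_{pq}\ge 0$. Given $\alpha\in\mathbb{R}^P$, the contribution function is $C^\alpha(z):=\sum_{q\in P}(\alpha_q-d(z,q))_+$, for a point $z$ of the metric space. *)

theory Defs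
  imports "HOL-Analysis.Analysis"
begin

text \<open>
  Vectors indexed by \<^term>\<open>P\<close> and by \<^term>\<open>P \<times> P\<close> are represented by functions on the whole type;
  only their values on \<^term>\<open>P\<close> matter, so two solutions count as equal when they agree there.
\<close>

definition kmedian_cost :: "'a set \<Rightarrow> ('a \<Rightarrow> 'a \<Rightarrow> real) \<Rightarrow> ('a \<Rightarrow> 'a \<Rightarrow> real) \<Rightarrow> real" where
  "kmedian_cost P d z = (\<Sum>p\<in>P. \<Sum>q\<in>P. d p q * z p q)"

definition kmedian_constraints :: "'a set \<Rightarrow> nat \<Rightarrow> ('a \<Rightarrow> real) \<Rightarrow> ('a \<Rightarrow> 'a \<Rightarrow> real) \<Rightarrow> bool" where
  "kmedian_constraints P k y z \<longleftrightarrow>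
     (\<forall>q\<in>P. (\<Sum>p\<in>P. z p q) = 1) \<and>
     (\<forall>p\<in>P. \<forall>q\<in>P. z p q \<le> y p) \<and>
     (\<Sum>p\<in>P. y p) = real k"

definition IP_feasible :: "'a set \<Rightarrow> nat \<Rightarrow> ('a \<Rightarrow> real) \<Rightarrow> ('a \<Rightarrow> 'a \<Rightarrow> real) \<Rightarrow> bool" where
  "IP_feasible P k y z \<longleftrightarrow>
     kmedian_constraints P k y z \<and>
     (\<forall>p\<in>P. y p \<in> {0, 1}) \<and> (\<forall>p\<in>P. \<forall>q\<in>P. z p q \<in> {0, 1})"

definition LP_feasible :: "'a set \<Rightarrow> nat \<Rightarrow> ('a \<Rightarrow> real) \<Rightarrow> ('a \<Rightarrow> 'a \<Rightarrow> real) \<Rightarrow> bool" where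
  "LP_feasible P k y z \<longleftrightarrow>
     kmedian_constraints P k y z \<and>
     (\<forall>p\<in>P. y p \<ge> 0) \<and> (\<forall>p\<in>P. \<forall>q\<in>P. z p q \<ge> 0)"

definition LP_optimal ::
  "'a set \<Rightarrow> ('a \<Rightarrow> 'a \<Rightarrow> real) \<Rightarrow> nat \<Rightarrow> ('a \<Rightarrow> real) \<Rightarrow> ('a \<Rightarrow> 'a \<Rightarrow> real) \<Rightarrow> bool" where
  "LP_optimal P d k y z \<longleftrightarrow>
     LP_feasible P k y z \<and>
     (\<forall>y' z'. LP_feasible P k y' z' \<longrightarrow> kmedian_cost P d z \<le> kmedian_cost P d z')"

definition LP_unique_optimal ::
  "'a set \<Rightarrow> ('a \<Rightarrow> 'a \<Rightarrow> real) \<Rightarrow> nat \<Rightarrow> ('a \<Rightarrow> real) \<Rightarrow> ('a \<Rightarrow> 'a \<Rightarrow> real) \<Rightarrow> bool" where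
  "LP_unique_optimal P d k y z \<longleftrightarrow>
     LP_optimal P d k y z \<and>
     (\<forall>y' z'. LP_optimal P d k y' z' \<longrightarrow>
        (\<forall>p\<in>P. y' p = y p) \<and> (\<forall>p\<in>P. \<forall>q\<in>P. z' p q = z p q))"

definition contribution ::
  "'a set \<Rightarrow> ('a \<Rightarrow> 'a \<Rightarrow> real) \<Rightarrow> ('a \<Rightarrow> real) \<Rightarrow> 'a \<Rightarrow> real" where
  "contribution P d \<alpha> x = (\<Sum>q\<in>P. max (\<alpha> q - d x q) 0)"

end

theory Submission
  imports Defs "HOL-Library.Function_Algebras"
begin

text \<open>
  For a feasible point of (LP) and any \<open>\<alpha>\<close>, \<open>M\<close>, the duality gap
  \<open>cost - (\<Sum>\<alpha> - k M)\<close> is a sum of complementary slackness terms. With \<open>M = C\<^sup>\<alpha>(a\<^sub>1)\<close>, conditions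
  (i)--(iv) make them vanish at the given integral point and nonnegative at every other one; strictness
  forces any optimal solution to have the same support. Conversely, if the integral point is optimal,
  no direction satisfying the homogeneous versions of the constraints tight there decreases the cost,
  and Farkas' lemma gives multipliers in which complementary slackness is already built in;
  \<open>\<alpha>\<close> is read off from those of the assignment equations.
\<close>

section \<open>Function spaces and Farkas' lemma\<close>

text \<open>Directions for (LP) are pairs of functions \<open>(u, w)\<close>; pointwise scaling
  turns them into real vectors, as the abstract form of Farkas' lemma requires.\<close>

instantiation "fun" :: (type, real_vector) real_vector
begin

definition scaleR_fun :: "real \<Rightarrow> ('a \<Rightarrow> 'b) \<Rightarrow> 'a \<Rightarrow> 'b" where
  "scaleR_fun c f = (\<lambda>x. c *\<^sub>R f x)"

instance
  by standard (auto simp: scaleR_fun_def fun_eq_iff scaleR_add_right scaleR_add_left)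

end

text \<open>
  Bartl's algebraic proof: if the last functional \<open>a j\<close> is needed, take \<open>e\<close> violating the
  implication without it, scaled so that \<open>a j e = 1\<close>, and apply the induction hypothesis to all
  functionals composed with the projection along \<open>e\<close> onto the kernel of \<open>a j\<close>.
\<close>

lemma farkas:
  fixes a :: "'i \<Rightarrow> 'v::real_vector \<Rightarrow> real"
  assumes "finite I" "\<And>i. i \<in> I \<Longrightarrow> linear (a i)" "linear g"
    and "\<And>x. (\<And>i. i \<in> I \<Longrightarrow> a i x \<le> 0) \<Longrightarrow> g x \<le> 0"
  shows "\<exists>l. (\<forall>i\<in>I. 0 \<le> l i) \<and> (\<forall>x. g x = (\<Sum>i\<in>I. l i * a i x))"
  using assms
proof (induction I arbitrary: a g rule: finite_induct)
  case empty
  have "g x = 0" for x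
    using empty.prems(3)[of x] empty.prems(3)[of "- x"] linear_neg[OF empty.prems(2), of x] by simp
  then show ?case by simp
next
  case (insert j I)
  note lin = insert.prems(1)
  have linj: "linear (a j)" and g: "linear g" using insert.prems by auto
  show ?case
  proof (cases "\<forall>x. (\<forall>i\<in>I. a i x \<le> 0) \<longrightarrow> g x \<le> 0")
    case True
    then obtain l where l: "\<forall>i\<in>I. 0 \<le> l i" "\<forall>x. g x = (\<Sum>i\<in>I. l i * a i x)"
      using insert.IH[of a g] lin g by auto
    have "(\<Sum>i\<in>insert j I. (l(j := 0)) i * a i x) = g x" for x
      using insert.hyps l(2) by (auto intro!: sum.cong)
    then show ?thesis using l(1) by (intro exI[of _ "l(j := 0)"]) auto
  next
    case False
    then obtain x0 where x0: "\<And>i. i \<in> I \<Longrightarrow> a i x0 \<le> 0" "g x0 > 0" by force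
    \<comment> \<open>Otherwise \<open>x0\<close> would satisfy every inequality, including the one
      for \<open>j\<close>, and yet have \<open>g x0 > 0\<close>.\<close>
    have "a j x0 > 0"
      using insert.prems(3)[of x0] x0 by fastforce
    define e where "e = x0 /\<^sub>R a j x0"
    have e: "a i e \<le> 0" if "i \<in> I" for i
      using x0(1)[OF that] \<open>a j x0 > 0\<close> linear_scale[OF lin[of i]] that
      by (auto simp: e_def mult_le_0_iff)
    have ej: "a j e = 1"
      using \<open>a j x0 > 0\<close> linear_scale[OF linj] by (simp add: e_def)
    have eg: "g e > 0"
      using \<open>a j x0 > 0\<close> x0(2) linear_scale[OF g] by (simp add: e_def)
    define a' where "a' = (\<lambda>i x. a i x - a i e * a j x)"
    define g' where "g' = (\<lambda>x. g x - g e * a j x)"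
    have proj: "f (x - a j x *\<^sub>R e) = f x - f e * a j x" if "linear f" for f :: "'v \<Rightarrow> real" and x
      using that by (simp add: linear_diff linear_scale)
    have lin': "linear (\<lambda>x. f x - c * a j x)" if "linear f" for f :: "'v \<Rightarrow> real" and c
      using that linj
      by (intro linearI) (auto simp: linear_add linear_scale algebra_simps)
    have "\<exists>l. (\<forall>i\<in>I. 0 \<le> l i) \<and> (\<forall>x. g' x = (\<Sum>i\<in>I. l i * a' i x))"
    proof (rule insert.IH)
      show "linear (a' i)" if "i \<in> I" for i
        using that lin unfolding a'_def by (intro lin') auto
      show "linear g'" using g unfolding g'_def by (rule lin')
      fix x assume x: "\<And>i. i \<in> I \<Longrightarrow> a' i x \<le> 0"
      have "a i (x - a j x *\<^sub>R e) \<le> 0" if "i \<in> insert j I" for i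
        using that x[of i] proj[OF lin[OF that], of x] ej by (auto simp: a'_def)
      then have "g (x - a j x *\<^sub>R e) \<le> 0" by (rule insert.prems(3))
      then show "g' x \<le> 0" using proj[OF g, of x] by (simp add: g'_def)
    qed
    then obtain l where l: "\<And>i. i \<in> I \<Longrightarrow> 0 \<le> l i" "\<And>x. g' x = (\<Sum>i\<in>I. l i * a' i x)"
      by blast
    \<comment> \<open>Substituting the definitions of \<open>g'\<close> and \<open>a'\<close> into
      the expansion of \<open>g'\<close>, this is the total coefficient of \<open>a j\<close>. It is
      nonnegative because \<open>g e > 0\<close> and every \<open>a i e\<close> with
      \<open>i\<close> in \<open>I\<close> is at most 0.\<close>
    define c where "c = g e - (\<Sum>i\<in>I. l i * a i e)"
    have "(\<Sum>i\<in>I. l i * a i e) \<le> 0"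
      by (intro sum_nonpos mult_nonneg_nonpos l(1) e)
    then have "c \<ge> 0" using eg by (simp add: c_def)
    have "g x = (\<Sum>i\<in>insert j I. (l(j := c)) i * a i x)" for x
    proof -
      have "g x = g e * a j x + (\<Sum>i\<in>I. l i * a' i x)"
        using l(2)[of x] by (simp add: g'_def)
      also have "\<dots> = c * a j x + (\<Sum>i\<in>I. l i * a i x)"
        by (simp add: a'_def c_def algebra_simps sum_subtractf sum_distrib_left sum_distrib_right)
      also have "(\<Sum>i\<in>I. l i * a i x) = (\<Sum>i\<in>I. (l(j := c)) i * a i x)"
        using insert.hyps by (intro sum.cong) auto
      finally show ?thesis using insert.hyps by simp
    qed
    then show ?thesis using l(1) \<open>c \<ge> 0\<close> by (intro exI[of _ "l(j := c)"]) auto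
  qed
qed

text \<open>An equation is a pair of opposite inequalities; the difference of their two nonnegative
  multipliers is a multiplier of arbitrary sign.\<close>

corollary farkas_equations:
  fixes a :: "'i \<Rightarrow> 'v::real_vector \<Rightarrow> real" and b :: "'e \<Rightarrow> 'v \<Rightarrow> real"
  assumes "finite I" "finite E" "\<And>i. i \<in> I \<Longrightarrow> linear (a i)" "\<And>i. i \<in> E \<Longrightarrow> linear (b i)" "linear g"
    and "\<And>x. (\<And>i. i \<in> I \<Longrightarrow> a i x \<le> 0) \<Longrightarrow> (\<And>i. i \<in> E \<Longrightarrow> b i x = 0) \<Longrightarrow> g x \<le> 0"
  shows "\<exists>l m. (\<forall>i\<in>I. 0 \<le> l i) \<and>
    (\<forall>x. g x = (\<Sum>i\<in>I. l i * a i x) + (\<Sum>i\<in>E. m i * b i x))"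
proof -
  define c where "c = case_sum a (case_sum b (\<lambda>i x. - b i x))"
  have "\<exists>l. (\<forall>i\<in>I <+> E <+> E. 0 \<le> l i) \<and> (\<forall>x. g x = (\<Sum>i\<in>I <+> E <+> E. l i * c i x))"
  proof (rule farkas)
    show "linear (c i)" if "i \<in> I <+> E <+> E" for i
      using that assms(3,4) by (auto simp: c_def linear_compose_neg)
    fix x assume x: "\<And>i. i \<in> I <+> E <+> E \<Longrightarrow> c i x \<le> 0"
    show "g x \<le> 0"
    proof (rule assms(6))
      show "a i x \<le> 0" if "i \<in> I" for i using x[of "Inl i"] that by (auto simp: c_def)
      show "b i x = 0" if "i \<in> E" for i
        using x[of "Inr (Inl i)"] x[of "Inr (Inr i)"] that by (simp add: c_def InrI InlI)
    qed
  qed (use assms in auto)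
  then obtain l where l: "\<forall>i\<in>I <+> E <+> E. 0 \<le> l i"
    "\<And>x. g x = (\<Sum>i\<in>I <+> E <+> E. l i * c i x)" by blast
  have "g x = (\<Sum>i\<in>I. l (Inl i) * a i x) +
      (\<Sum>i\<in>E. (l (Inr (Inl i)) - l (Inr (Inr i))) * b i x)" for x
    using assms(1,2) unfolding l(2)
    by (simp add: sum.Plus c_def algebra_simps sum_subtractf sum_negf)
  then show ?thesis using l(1)
    by (intro exI[of _ "\<lambda>i. l (Inl i)"] exI[of _ "\<lambda>i. l (Inr (Inl i)) - l (Inr (Inr i))"]) auto
qed

section \<open>Feasibility and the duality gap\<close>

lemma IP_feasible_imp_LP_feasible: "IP_feasible P k y z \<Longrightarrow> LP_feasible P k y z"
  unfolding IP_feasible_def LP_feasible_def by fastforce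

lemma LP_feasible_le: "LP_feasible P k y z \<Longrightarrow> p \<in> P \<Longrightarrow> q \<in> P \<Longrightarrow> z p q \<le> y p"
  and LP_feasible_nonneg: "LP_feasible P k y z \<Longrightarrow> p \<in> P \<Longrightarrow> q \<in> P \<Longrightarrow> 0 \<le> z p q"
  and LP_feasible_y_nonneg: "LP_feasible P k y z \<Longrightarrow> p \<in> P \<Longrightarrow> 0 \<le> y p"
  and LP_feasible_sum_z: "LP_feasible P k y z \<Longrightarrow> q \<in> P \<Longrightarrow> (\<Sum>p\<in>P. z p q) = 1"
  and LP_feasible_sum_y: "LP_feasible P k y z \<Longrightarrow> (\<Sum>p\<in>P. y p) = real k"
  unfolding LP_feasible_def kmedian_constraints_def by blast+

text \<open>
  The duality gap of \<^term>\<open>\<alpha>\<close> and \<^term>\<open>M\<close>, split into the nonnegative terms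
  whose vanishing is complementary slackness.
\<close>

lemma duality_gap:
  assumes "LP_feasible P k y z"
  shows "kmedian_cost P d z - ((\<Sum>q\<in>P. \<alpha> q) - real k * M) =
    (\<Sum>p\<in>P. \<Sum>q\<in>P. max (d p q - \<alpha> q) 0 * z p q + max (\<alpha> q - d p q) 0 * (y p - z p q)) +
    (\<Sum>p\<in>P. (M - contribution P d \<alpha> p) * y p)"
proof -
  have "(\<Sum>q\<in>P. \<alpha> q) = (\<Sum>q\<in>P. \<alpha> q * (\<Sum>p\<in>P. z p q))"
    using LP_feasible_sum_z[OF assms] by simp
  also have "\<dots> = (\<Sum>p\<in>P. \<Sum>q\<in>P. \<alpha> q * z p q)"
    unfolding sum_distrib_left by (rule sum.swap)
  finally have "kmedian_cost P d z - (\<Sum>q\<in>P. \<alpha> q) = (\<Sum>p\<in>P. \<Sum>q\<in>P. (d p q - \<alpha> q) * z p q)"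
    by (simp add: kmedian_cost_def sum_subtractf algebra_simps)
  \<comment> \<open>Termwise, split \<open>d - \<alpha>\<close> into positive and negative part and
    write \<open>- z = (y - z) - y\<close> in the negative one. The leftover
    \<open>- max (\<alpha> q - d p q) 0 * y p\<close> sums over \<open>q\<close> to minus the
    contribution of \<open>p\<close> times \<open>y p\<close>.\<close>
  also have "\<dots> = (\<Sum>p\<in>P. (\<Sum>q\<in>P. max (d p q - \<alpha> q) 0 * z p q + max (\<alpha> q - d p q) 0 * (y p - z p q))
      - contribution P d \<alpha> p * y p)"
    unfolding contribution_def sum_distrib_right sum_subtractf[symmetric]
    by (intro sum.cong refl) (auto simp: max_def algebra_simps)
  finally show ?thesis
    using LP_feasible_sum_y[OF assms]
    by (simp add: sum_subtractf sum.distrib algebra_simps flip: sum_distrib_left)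
qed

section \<open>Directions at an integral optimum and their multipliers\<close>

text \<open>A short step along \<open>(u, w)\<close> stays feasible: the premises protect the tight
  constraints among \<open>0 \<le> z \<le> y\<close>, and at a 0-1 point the others have slack
  exactly 1. Optimality then forbids a decrease of the cost.\<close>

lemma LP_optimal_direction:
  assumes fin: "finite P" and feas: "IP_feasible P k y z" and opt: "LP_optimal P d k y z"
    and tight: "\<And>p q. p \<in> P \<Longrightarrow> q \<in> P \<Longrightarrow> z p q = y p \<Longrightarrow> w p q \<le> u p"
      "\<And>p q. p \<in> P \<Longrightarrow> q \<in> P \<Longrightarrow> z p q = 0 \<Longrightarrow> 0 \<le> w p q"
    and sums: "\<And>q. q \<in> P \<Longrightarrow> (\<Sum>p\<in>P. w p q) = 0" "(\<Sum>p\<in>P. u p) = 0"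
  shows "0 \<le> kmedian_cost P d w"
proof -
  note LP = IP_feasible_imp_LP_feasible[OF feas]
  \<comment> \<open>The step length is \<open>1 / c\<close>. The sums bound all entries of
    \<open>w\<close> and \<open>u\<close>, and the added 1 keeps \<open>c\<close> positive for the
    zero direction.\<close>
  define c where "c = (\<Sum>p\<in>P. \<Sum>q\<in>P. \<bar>w p q\<bar>) + (\<Sum>p\<in>P. \<bar>u p\<bar>) + 1"
  have wu: "\<bar>w p q\<bar> + \<bar>u p\<bar> \<le> c" if "p \<in> P" "q \<in> P" for p q
  proof -
    have "\<bar>w p q\<bar> \<le> (\<Sum>q\<in>P. \<bar>w p q\<bar>)" using fin that by (intro member_le_sum) auto
    also have "\<dots> \<le> (\<Sum>p\<in>P. \<Sum>q\<in>P. \<bar>w p q\<bar>)"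
      using fin that by (intro member_le_sum[of _ _ "\<lambda>p. \<Sum>q\<in>P. \<bar>w p q\<bar>"]) (auto intro: sum_nonneg)
    finally have "\<bar>w p q\<bar> \<le> (\<Sum>p\<in>P. \<Sum>q\<in>P. \<bar>w p q\<bar>)" .
    moreover have "\<bar>u p\<bar> \<le> (\<Sum>p\<in>P. \<bar>u p\<bar>)"
      using fin that by (intro member_le_sum[of _ _ "\<lambda>p. \<bar>u p\<bar>"]) auto
    ultimately show ?thesis by (simp add: c_def)
  qed
  have "c > 0" unfolding c_def by (intro add_nonneg_pos add_nonneg_nonneg sum_nonneg) auto
  define y' where "y' p = y p + u p / c" for p
  define z' where "z' p q = z p q + w p q / c" for p q
  have val: "y p \<in> {0, 1}" "z p q \<in> {0, 1}" "z p q \<le> y p" if "p \<in> P" "q \<in> P" for p q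
    using feas that unfolding IP_feasible_def kmedian_constraints_def by blast+
  have z': "0 \<le> z' p q \<and> z' p q \<le> y' p" if "p \<in> P" "q \<in> P" for p q
  proof -
    \<comment> \<open>No constraint loses more than 1, the slack of a constraint that is not
      tight.\<close>
    have "\<bar>w p q / c\<bar> + \<bar>u p / c\<bar> \<le> 1"
      using wu[OF that] \<open>c > 0\<close> by (simp add: divide_simps)
    moreover have "z p q = y p \<Longrightarrow> w p q / c \<le> u p / c"
      using tight(1)[OF that] \<open>c > 0\<close> by (simp add: divide_right_mono)
    moreover have "z p q = 0 \<Longrightarrow> 0 \<le> w p q / c"
      using tight(2)[OF that] \<open>c > 0\<close> by simp
    ultimately show ?thesis using val[OF that] by (auto simp: y'_def z'_def simp del: abs_divide)
  qed
  have "LP_feasible P k y' z'"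
    unfolding LP_feasible_def kmedian_constraints_def
  proof (intro conjI ballI)
    show "(\<Sum>p\<in>P. z' p q) = 1" if "q \<in> P" for q
      using LP_feasible_sum_z[OF LP that] sums(1)[OF that]
      by (simp add: z'_def sum.distrib flip: sum_divide_distrib)
    show "(\<Sum>p\<in>P. y' p) = real k"
      using LP_feasible_sum_y[OF LP] sums(2) by (simp add: y'_def sum.distrib flip: sum_divide_distrib)
    \<comment> \<open>Nonnegativity of \<open>y'\<close> is read off from
      \<open>0 \<le> z' p p \<le> y' p\<close>.\<close>
    show "0 \<le> y' p" if "p \<in> P" for p using z'[OF that that] by linarith
  qed (use z' in auto)
  then have "kmedian_cost P d z \<le> kmedian_cost P d z'" using opt by (simp add: LP_optimal_def)
  also have "\<dots> = kmedian_cost P d z + kmedian_cost P d w / c"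
    by (simp add: kmedian_cost_def z'_def distrib_left sum.distrib sum_divide_distrib)
  finally show ?thesis using \<open>c > 0\<close> by (simp add: zero_le_divide_iff)
qed

text \<open>Farkas' lemma applied to the preceding directions yields \<open>\<beta>\<close> for
  \<open>z \<le> y\<close>, \<open>\<nu>\<close> for \<open>z \<ge> 0\<close>,
  \<open>\<alpha>\<close> for the assignment equations and \<open>\<mu>\<close> for the number of
  centers. Only tight constraints receive multipliers, so complementary slackness is built in; the
  last two conclusions compare coefficients of \<open>w p q\<close> and \<open>u p\<close>.\<close>

lemma LP_multipliers:
  fixes d :: "'a \<Rightarrow> 'a \<Rightarrow> real"
  assumes fin: "finite P" and feas: "IP_feasible P k y z" and opt: "LP_optimal P d k y z"
  obtains \<alpha> \<beta> \<nu> \<mu> where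
    "\<And>p q. p \<in> P \<Longrightarrow> q \<in> P \<Longrightarrow> 0 \<le> \<beta> p q" "\<And>p q. p \<in> P \<Longrightarrow> q \<in> P \<Longrightarrow> 0 \<le> \<nu> p q"
    "\<And>p q. z p q \<noteq> y p \<Longrightarrow> \<beta> p q = 0" "\<And>p q. z p q \<noteq> 0 \<Longrightarrow> \<nu> p q = 0"
    "\<And>p q. p \<in> P \<Longrightarrow> q \<in> P \<Longrightarrow> \<alpha> q - d p q = \<beta> p q - \<nu> p q"
    "\<And>p. p \<in> P \<Longrightarrow> (\<Sum>q\<in>P. \<beta> p q) = \<mu>"
proof -
  define T where "T = {(p, q) \<in> P \<times> P. z p q = y p}"
  define W where "W = {(p, q) \<in> P \<times> P. z p q = 0}"
  have [simp]: "finite T" "finite W"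
    using fin by (auto simp: T_def W_def intro: finite_subset[OF _ finite_cartesian_product[OF fin fin]])
  define a :: "('a \<times> 'a) + ('a \<times> 'a) \<Rightarrow> ('a \<Rightarrow> real) \<times> ('a \<Rightarrow> 'a \<Rightarrow> real) \<Rightarrow> real"
    where "a = case_sum (\<lambda>(p, q) x. snd x p q - fst x p) (\<lambda>(p, q) x. - snd x p q)"
  define b :: "'a + unit \<Rightarrow> ('a \<Rightarrow> real) \<times> ('a \<Rightarrow> 'a \<Rightarrow> real) \<Rightarrow> real"
    where "b = case_sum (\<lambda>q x. \<Sum>p\<in>P. snd x p q) (\<lambda>_ x. \<Sum>p\<in>P. fst x p)"
  have "\<exists>l m. (\<forall>i\<in>T <+> W. 0 \<le> l i) \<and> (\<forall>x. - kmedian_cost P d (snd x) =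
      (\<Sum>i\<in>T <+> W. l i * a i x) + (\<Sum>i\<in>P <+> {()}. m i * b i x))"
  proof (rule farkas_equations)
    show "linear (a i)" for i
      by (intro linearI) (auto simp: a_def scaleR_fun_def algebra_simps split: sum.split)
    show "linear (b i)" for i
      by (intro linearI)
        (auto simp: b_def scaleR_fun_def sum.distrib sum_distrib_left split: sum.split)
    show "linear (\<lambda>x. - kmedian_cost P d (snd x))"
      by (intro linearI)
        (auto simp: kmedian_cost_def scaleR_fun_def sum.distrib sum_distrib_left algebra_simps)
    fix x assume x: "\<And>i. i \<in> T <+> W \<Longrightarrow> a i x \<le> 0" "\<And>i. i \<in> P <+> {()} \<Longrightarrow> b i x = 0"
    have "0 \<le> kmedian_cost P d (snd x)"
    proof (rule LP_optimal_direction[OF fin feas opt])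
      show "snd x p q \<le> fst x p" if "p \<in> P" "q \<in> P" "z p q = y p" for p q
        using x(1)[of "Inl (p, q)"] that by (simp add: InlI T_def a_def)
      show "0 \<le> snd x p q" if "p \<in> P" "q \<in> P" "z p q = 0" for p q
        using x(1)[of "Inr (p, q)"] that by (simp add: InrI W_def a_def)
      show "(\<Sum>p\<in>P. snd x p q) = 0" if "q \<in> P" for q
        using x(2)[of "Inl q"] that by (simp add: InlI b_def)
      show "(\<Sum>p\<in>P. fst x p) = 0"
        using x(2)[of "Inr ()"] by (simp add: InrI b_def)
    qed
    then show "- kmedian_cost P d (snd x) \<le> 0" by simp
  qed (use fin in auto)
  then obtain l m where l: "\<forall>i\<in>T <+> W. 0 \<le> l i"
    and lm: "\<And>x. - kmedian_cost P d (snd x) =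
      (\<Sum>i\<in>T <+> W. l i * a i x) + (\<Sum>i\<in>P <+> {()}. m i * b i x)" by blast
  define \<beta> where "\<beta> p q = (if z p q = y p then l (Inl (p, q)) else 0)" for p q
  define \<nu> where "\<nu> p q = (if z p q = 0 then l (Inr (p, q)) else 0)" for p q
  \<comment> \<open>The sign is reversed since Farkas' lemma was applied to minus the cost.\<close>
  define \<alpha> where "\<alpha> q = - m (Inl q)" for q
  define \<mu> where "\<mu> = m (Inr ())"
  \<comment> \<open>Extension by 0 lets the sums over tight pairs run over all of
    \<open>P \<times> P\<close>.\<close>
  have T: "(\<Sum>(p, q)\<in>T. l (Inl (p, q)) * f p q) = (\<Sum>p\<in>P. \<Sum>q\<in>P. \<beta> p q * f p q)" for f
    unfolding sum.cartesian_product
    by (rule sum.mono_neutral_cong_left) (use fin in \<open>auto simp: T_def \<beta>_def split: if_splits\<close>)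
  have W: "(\<Sum>(p, q)\<in>W. l (Inr (p, q)) * f p q) = (\<Sum>p\<in>P. \<Sum>q\<in>P. \<nu> p q * f p q)" for f
    unfolding sum.cartesian_product
    by (rule sum.mono_neutral_cong_left) (use fin in \<open>auto simp: W_def \<nu>_def split: if_splits\<close>)
  have key: "- kmedian_cost P d w = (\<Sum>p\<in>P. \<Sum>q\<in>P. \<beta> p q * (w p q - u p))
      + (\<Sum>p\<in>P. \<Sum>q\<in>P. \<nu> p q * - w p q)
      + ((\<Sum>q\<in>P. - \<alpha> q * (\<Sum>p\<in>P. w p q)) + \<mu> * (\<Sum>p\<in>P. u p))" for u w
    unfolding T[symmetric] W[symmetric] using lm[of "(u, w)"] fin
    by (simp add: sum.Plus a_def b_def \<alpha>_def \<mu>_def case_prod_unfold)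
  show ?thesis
  proof (rule that[of \<beta> \<nu> \<alpha> \<mu>])
    show "0 \<le> \<beta> p q" "0 \<le> \<nu> p q" if "p \<in> P" "q \<in> P" for p q
      using l that by (auto simp: \<beta>_def \<nu>_def T_def W_def)
    show "\<alpha> q - d p q = \<beta> p q - \<nu> p q" if "p \<in> P" "q \<in> P" for p q
    proof -
      \<comment> \<open>Testing \<open>key\<close> on the unit direction at \<open>(p, q)\<close>,
        with \<open>u = 0\<close>, isolates the coefficient of \<open>w p q\<close>.\<close>
      define w where "w p' q' = (if p' = p \<and> q' = q then 1 else (0::real))" for p' q' :: 'a
      have "f p' q' * w p' q' = (if q' = q then if p' = p then f p q else 0 else 0)" for f p' q'
        by (simp add: w_def)
      then have w1: "(\<Sum>p'\<in>P. \<Sum>q'\<in>P. f p' q' * w p' q') = f p q" for f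
        using fin that by simp
      have w2: "(\<Sum>p'\<in>P. w p' q') = (if q' = q then 1 else 0)" for q'
        using fin that by (cases "q' = q") (simp_all add: w_def)
      have "(\<Sum>q'\<in>P. \<alpha> q' * (\<Sum>p'\<in>P. w p' q')) = \<alpha> q"
        using fin that by (simp add: w2 if_distrib cong: if_cong)
      with key[of w "\<lambda>_. 0"] show ?thesis
        by (simp add: w1 kmedian_cost_def sum_negf)
    qed
    show "(\<Sum>q\<in>P. \<beta> p q) = \<mu>" if "p \<in> P" for p
    proof -
      \<comment> \<open>Here the test direction is the unit vector at \<open>p\<close> in the
        \<open>u\<close> component, with \<open>w = 0\<close>.\<close>
      have "(\<Sum>p'\<in>P. \<Sum>q\<in>P. \<beta> p' q * (if p' = p then 1 else 0)) =
          (\<Sum>p'\<in>P. if p' = p then \<Sum>q\<in>P. \<beta> p q else 0)"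
        by (intro sum.cong) auto
      then show ?thesis
        using key[of "\<lambda>_ _. 0" "\<lambda>p'. if p' = p then 1 else 0"] fin that
        by (simp add: kmedian_cost_def sum_negf)
    qed
  qed (auto simp: \<beta>_def \<nu>_def)
qed

section \<open>Optimality and uniqueness criterion\<close>

theorem theorem1:
  fixes X P :: "'a set" and d :: "'a \<Rightarrow> 'a \<Rightarrow> real" and n k :: nat
    and ybar :: "'a \<Rightarrow> real" and zbar :: "'a \<Rightarrow> 'a \<Rightarrow> real"
    and a :: "nat \<Rightarrow> 'a" and A :: "nat \<Rightarrow> 'a set"
  assumes metric: "Metric_space X d"
    and P: "P \<subseteq> X" "finite P" "card P = n"
    and k: "1 \<le> k" "k \<le> n"
    and feas: "IP_feasible P k ybar zbar"
    and a: "bij_betw a {1..k} {p \<in> P. ybar p = 1}"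
    and A: "\<And>i. i \<in> {1..k} \<Longrightarrow> A i = {q \<in> P. zbar (a i) q = 1}"
  shows "(LP_optimal P d k ybar zbar \<longleftrightarrow>
           (\<exists>\<alpha> :: 'a \<Rightarrow> real.
              (\<forall>i\<in>{1..k}. \<forall>j\<in>{1..k}. contribution P d \<alpha> (a i) = contribution P d \<alpha> (a j)) \<and>
              (\<forall>q\<in>P - a ` {1..k}. contribution P d \<alpha> q \<le> contribution P d \<alpha> (a 1)) \<and>
              (\<forall>i\<in>{1..k}. \<forall>q\<in>A i. \<alpha> q \<ge> d (a i) q) \<and>
              (\<forall>i\<in>{1..k}. \<forall>q\<in>P - A i. \<alpha> q \<le> d (a i) q)))
       \<and> ((\<exists>\<alpha> :: 'a \<Rightarrow> real.
              (\<forall>i\<in>{1..k}. \<forall>j\<in>{1..k}. contribution P d \<alpha> (a i) = contribution P d \<alpha> (a j)) \<and>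
              (\<forall>q\<in>P - a ` {1..k}. contribution P d \<alpha> q < contribution P d \<alpha> (a 1)) \<and>
              (\<forall>i\<in>{1..k}. \<forall>q\<in>A i. \<alpha> q \<ge> d (a i) q) \<and>
              (\<forall>i\<in>{1..k}. \<forall>q\<in>P - A i. \<alpha> q < d (a i) q))
           \<longrightarrow> LP_unique_optimal P d k ybar zbar)"
proof -
  define C where "C = contribution P d"
  define S where "S = a ` {1..k}"
  note LP = IP_feasible_imp_LP_feasible[OF feas]
  have S: "S = {p \<in> P. ybar p = 1}"
    using a by (simp add: S_def bij_betw_def)
  have "a 1 \<in> S" using k by (auto simp: S_def)
  have val: "ybar p \<in> {0, 1}" "zbar p q \<in> {0, 1}" if "p \<in> P" "q \<in> P" for p q
    using feas that unfolding IP_feasible_def by blast+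
  have y0: "ybar p = 0" "zbar p q = 0" if "p \<in> P - S" "q \<in> P" for p q
  proof -
    show "ybar p = 0" using val(1)[of p q] that by (auto simp: S)
    then show "zbar p q = 0"
      using LP_feasible_le[OF LP, of p q] LP_feasible_nonneg[OF LP, of p q] that by auto
  qed
  \<comment> \<open>Since \<open>zbar\<close> is 0-1 valued, lying outside \<open>A i\<close> means
    \<open>zbar (a i) q = 0\<close>. The arbitrary \<open>Q\<close> covers (iii) and both the weak
    and the strict form of (iv).\<close>
  have A_iff: "(\<forall>i\<in>{1..k}. \<forall>q\<in>A i. Q (a i) q) \<longleftrightarrow> (\<forall>p\<in>S. \<forall>q\<in>P. zbar p q = 1 \<longrightarrow> Q p q)"
    "(\<forall>i\<in>{1..k}. \<forall>q\<in>P - A i. Q (a i) q) \<longleftrightarrow> (\<forall>p\<in>S. \<forall>q\<in>P. zbar p q = 0 \<longrightarrow> Q p q)" for Q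
  proof -
    have "A i = {q \<in> P. zbar (a i) q = 1}" "P - A i = {q \<in> P. zbar (a i) q = 0}"
      if "i \<in> {1..k}" for i
    proof -
      have "a i \<in> P" using that S by (auto simp: S_def)
      then show "P - A i = {q \<in> P. zbar (a i) q = 0}" using A[OF that] val(2)[of "a i"] by auto
    qed (rule A[OF that])
    then show "(\<forall>i\<in>{1..k}. \<forall>q\<in>A i. Q (a i) q) \<longleftrightarrow> (\<forall>p\<in>S. \<forall>q\<in>P. zbar p q = 1 \<longrightarrow> Q p q)"
      "(\<forall>i\<in>{1..k}. \<forall>q\<in>P - A i. Q (a i) q) \<longleftrightarrow> (\<forall>p\<in>S. \<forall>q\<in>P. zbar p q = 0 \<longrightarrow> Q p q)"
      unfolding S_def by auto
  qed

  \<comment> \<open>Sufficiency of (i)-(iv)\<close>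
  \<comment> \<open>Every gap term vanishes: outside \<open>S\<close> both \<open>ybar\<close> and
    \<open>zbar\<close> are 0; on \<open>S\<close>, where \<open>ybar\<close> is 1, (iii) handles
    \<open>zbar = 1\<close>, (iv) handles \<open>zbar = 0\<close>, and (i) the contribution
    term.\<close>
  have gap0: "kmedian_cost P d zbar = (\<Sum>q\<in>P. \<alpha> q) - real k * C \<alpha> (a 1)"
    if "\<forall>p\<in>S. C \<alpha> p = C \<alpha> (a 1)" "\<forall>p\<in>S. \<forall>q\<in>P. zbar p q = 1 \<longrightarrow> d p q \<le> \<alpha> q"
      "\<forall>p\<in>S. \<forall>q\<in>P. zbar p q = 0 \<longrightarrow> \<alpha> q \<le> d p q" for \<alpha>
  proof -
    have "max (d p q - \<alpha> q) 0 * zbar p q + max (\<alpha> q - d p q) 0 * (ybar p - zbar p q) = 0"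
      if "p \<in> P" "q \<in> P" for p q
    proof (cases "p \<in> S")
      case True
      then have "zbar p q = 1 \<Longrightarrow> d p q \<le> \<alpha> q" "zbar p q = 0 \<Longrightarrow> \<alpha> q \<le> d p q"
        using that \<open>\<forall>p\<in>S. \<forall>q\<in>P. zbar p q = 1 \<longrightarrow> d p q \<le> \<alpha> q\<close>
          \<open>\<forall>p\<in>S. \<forall>q\<in>P. zbar p q = 0 \<longrightarrow> \<alpha> q \<le> d p q\<close> by blast+
      then show ?thesis using True val(2)[OF that] by (auto simp: S)
    qed (use that y0 in auto)
    moreover have "(C \<alpha> (a 1) - C \<alpha> p) * ybar p = 0" if "p \<in> P" for p
      using \<open>\<forall>p\<in>S. C \<alpha> p = C \<alpha> (a 1)\<close> y0(1)[of p p] that by (cases "p \<in> S") auto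
    ultimately have "kmedian_cost P d zbar - ((\<Sum>q\<in>P. \<alpha> q) - real k * C \<alpha> (a 1)) = 0"
      unfolding duality_gap[OF LP] C_def by (simp only: sum.neutral_const cong: sum.cong)
    then show ?thesis by simp
  qed
  have terms: "0 \<le> max (d p q - \<alpha> q) 0 * z p q + max (\<alpha> q - d p q) 0 * (y p - z p q)"
    if "LP_feasible P k y z" "p \<in> P" "q \<in> P" for \<alpha> y z p q
    using LP_feasible_le[OF that] LP_feasible_nonneg[OF that] by simp
  have opt: "LP_optimal P d k ybar zbar"
    if \<alpha>: "\<forall>p\<in>S. C \<alpha> p = C \<alpha> (a 1)" "\<forall>p\<in>P - S. C \<alpha> p \<le> C \<alpha> (a 1)"
      "\<forall>p\<in>S. \<forall>q\<in>P. zbar p q = 1 \<longrightarrow> d p q \<le> \<alpha> q"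
      "\<forall>p\<in>S. \<forall>q\<in>P. zbar p q = 0 \<longrightarrow> \<alpha> q \<le> d p q" for \<alpha>
    unfolding LP_optimal_def
  proof (intro conjI allI impI)
    fix y z assume F: "LP_feasible P k y z"
    have "0 \<le> kmedian_cost P d z - ((\<Sum>q\<in>P. \<alpha> q) - real k * C \<alpha> (a 1))"
      unfolding duality_gap[OF F]
    proof (intro add_nonneg_nonneg sum_nonneg)
      show "0 \<le> (C \<alpha> (a 1) - contribution P d \<alpha> p) * y p" if "p \<in> P" for p
        using \<alpha>(1,2) that LP_feasible_y_nonneg[OF F that] by (cases "p \<in> S") (auto simp: C_def)
    qed (use LP_feasible_le[OF F] LP_feasible_nonneg[OF F] in auto)
    then show "kmedian_cost P d zbar \<le> kmedian_cost P d z"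
      using gap0[OF \<alpha>(1,3,4)] by simp
  qed (rule LP)

  \<comment> \<open>Necessity of (i)-(iv)\<close>
  have dual: "\<exists>\<alpha>. (\<forall>p\<in>S. \<forall>p'\<in>S. C \<alpha> p = C \<alpha> p') \<and> (\<forall>p\<in>P - S. C \<alpha> p \<le> C \<alpha> (a 1)) \<and>
      (\<forall>p\<in>S. \<forall>q\<in>P. zbar p q = 1 \<longrightarrow> d p q \<le> \<alpha> q) \<and>
      (\<forall>p\<in>S. \<forall>q\<in>P. zbar p q = 0 \<longrightarrow> \<alpha> q \<le> d p q)"
    if opt: "LP_optimal P d k ybar zbar"
  proof -
    obtain \<alpha> \<beta> \<nu> \<mu> where m:
      "\<And>p q. p \<in> P \<Longrightarrow> q \<in> P \<Longrightarrow> 0 \<le> \<beta> p q" "\<And>p q. p \<in> P \<Longrightarrow> q \<in> P \<Longrightarrow> 0 \<le> \<nu> p q"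
      "\<And>p q. zbar p q \<noteq> ybar p \<Longrightarrow> \<beta> p q = 0" "\<And>p q. zbar p q \<noteq> 0 \<Longrightarrow> \<nu> p q = 0"
      "\<And>p q. p \<in> P \<Longrightarrow> q \<in> P \<Longrightarrow> \<alpha> q - d p q = \<beta> p q - \<nu> p q"
      "\<And>p. p \<in> P \<Longrightarrow> (\<Sum>q\<in>P. \<beta> p q) = \<mu>"
      by (rule LP_multipliers[OF P(2) feas opt, of thesis]) (rule that, assumption+)
    \<comment> \<open>As \<open>\<alpha> q - d p q = \<beta> p q - \<nu> p q\<close> with both
      multipliers nonnegative, \<open>\<beta> p q\<close> dominates the positive part.\<close>
    have le: "C \<alpha> p \<le> \<mu>" if "p \<in> P" for p
      unfolding C_def contribution_def m(6)[OF that, symmetric]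
    proof (rule sum_mono)
      fix q assume "q \<in> P"
      then show "max (\<alpha> q - d p q) 0 \<le> \<beta> p q"
        using m(1,2,5)[OF that \<open>q \<in> P\<close>] by simp
    qed
    have one: "\<alpha> q - d p q = \<beta> p q" if "p \<in> S" "q \<in> P" "zbar p q = 1" for p q
      using m(4)[of p q] m(5)[of p q] that by (simp add: S)
    have zero: "\<alpha> q - d p q = - \<nu> p q" "\<beta> p q = 0" if "p \<in> S" "q \<in> P" "zbar p q = 0" for p q
      using m(3)[of p q] m(5)[of p q] that by (simp_all add: S)
    \<comment> \<open>At a center one of \<open>\<beta> p q\<close> and \<open>\<nu> p q\<close> is
      always 0, so \<open>\<beta> p q\<close> equals the positive part and the bound
      \<open>\<mu>\<close> is attained.\<close>
    have eq: "C \<alpha> p = \<mu>" if "p \<in> S" for p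
    proof -
      have "p \<in> P" using that by (simp add: S)
      have "max (\<alpha> q - d p q) 0 = \<beta> p q" if "q \<in> P" for q
        using val(2)[OF \<open>p \<in> P\<close> that] one[OF \<open>p \<in> S\<close> that] zero[OF \<open>p \<in> S\<close> that]
          m(1,2)[OF \<open>p \<in> P\<close> that] by auto
      then show ?thesis
        by (simp add: C_def contribution_def m(6)[OF \<open>p \<in> P\<close>])
    qed
    show ?thesis
    proof (intro exI[of _ \<alpha>] conjI ballI impI)
      show "d p q \<le> \<alpha> q" if "p \<in> S" "q \<in> P" "zbar p q = 1" for p q
        using one[OF that] m(1)[of p q] that by (simp add: S)
      show "\<alpha> q \<le> d p q" if "p \<in> S" "q \<in> P" "zbar p q = 0" for p q
        using zero(1)[OF that] m(2)[of p q] that by (simp add: S)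
    qed (use eq le \<open>a 1 \<in> S\<close> in auto)
  qed

  \<comment> \<open>Uniqueness under strict inequalities\<close>
  have unique: "LP_unique_optimal P d k ybar zbar"
    if \<alpha>: "\<forall>p\<in>S. C \<alpha> p = C \<alpha> (a 1)" "\<forall>p\<in>P - S. C \<alpha> p < C \<alpha> (a 1)"
      "\<forall>p\<in>S. \<forall>q\<in>P. zbar p q = 1 \<longrightarrow> d p q \<le> \<alpha> q"
      "\<forall>p\<in>S. \<forall>q\<in>P. zbar p q = 0 \<longrightarrow> \<alpha> q < d p q" for \<alpha>
    unfolding LP_unique_optimal_def
  proof (intro conjI allI impI)
    show O: "LP_optimal P d k ybar zbar"
      using \<alpha> by (intro opt[of \<alpha>]) (auto intro: less_imp_le)
    fix y z assume O': "LP_optimal P d k y z"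
    then have F: "LP_feasible P k y z" by (simp add: LP_optimal_def)
    note nonneg = LP_feasible_y_nonneg[OF F] LP_feasible_nonneg[OF F] LP_feasible_le[OF F]
    \<comment> \<open>Two optima have equal cost, so the gap is 0 at \<open>(y, z)\<close> too, and
      with it each of its nonnegative terms.\<close>
    have "kmedian_cost P d z = kmedian_cost P d zbar"
      using O O' unfolding LP_optimal_def by (meson order_antisym)
    then have "kmedian_cost P d z - ((\<Sum>q\<in>P. \<alpha> q) - real k * C \<alpha> (a 1)) = 0"
      using gap0[OF \<alpha>(1,3)] \<alpha>(4) by (simp add: less_imp_le)
    moreover define G where
      "G p q = max (d p q - \<alpha> q) 0 * z p q + max (\<alpha> q - d p q) 0 * (y p - z p q)" for p q
    ultimately have sum0:
      "(\<Sum>p\<in>P. \<Sum>q\<in>P. G p q) + (\<Sum>p\<in>P. (C \<alpha> (a 1) - C \<alpha> p) * y p) = 0"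
      unfolding duality_gap[OF F] C_def G_def by simp
    have C_le: "0 \<le> (C \<alpha> (a 1) - C \<alpha> p) * y p" if "p \<in> P" for p
      using \<alpha>(1,2) that nonneg(1)[OF that] by (cases "p \<in> S") (auto simp: less_imp_le)
    have G: "0 \<le> G p q" if "p \<in> P" "q \<in> P" for p q
      unfolding G_def by (rule terms[OF F that])
    then have inner: "0 \<le> (\<Sum>q\<in>P. G p q)" if "p \<in> P" for p
      using that by (intro sum_nonneg) auto
    have "0 \<le> (\<Sum>p\<in>P. \<Sum>q\<in>P. G p q)" "0 \<le> (\<Sum>p\<in>P. (C \<alpha> (a 1) - C \<alpha> p) * y p)"
      using inner C_le by (auto intro: sum_nonneg)
    with sum0 have sums0: "(\<Sum>p\<in>P. \<Sum>q\<in>P. G p q) = 0"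
      "(\<Sum>p\<in>P. (C \<alpha> (a 1) - C \<alpha> p) * y p) = 0"
      by linarith+
    \<comment> \<open>Strictness in (ii) makes the factor of \<open>y p\<close> positive.\<close>
    have y: "y p = 0" if "p \<in> P - S" for p
    proof -
      have "(C \<alpha> (a 1) - C \<alpha> p) * y p = 0"
        using sums0(2) sum_nonneg_eq_0_iff[OF P(2) C_le] that by auto
      then show ?thesis using \<alpha>(2) that by auto
    qed
    \<comment> \<open>Strictness in (iv) makes the coefficient of \<open>z p q\<close> in
      \<open>G p q\<close> positive, while the other summand of \<open>G p q\<close> is 0.\<close>
    have z_S: "z p q = 0" if "p \<in> S" "q \<in> P" "zbar p q = 0" for p q
    proof -
      have "p \<in> P" using that by (simp add: S)
      then have "G p q = 0"
        using sums0(1) sum_nonneg_eq_0_iff[OF P(2) inner] sum_nonneg_eq_0_iff[OF P(2) G] that by auto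
      moreover have "\<alpha> q < d p q" using \<alpha>(4) that by blast
      ultimately show ?thesis by (simp add: G_def)
    qed
    have z0: "z p q = 0" if "p \<in> P" "q \<in> P" "zbar p q = 0" for p q
      using z_S[OF _ that(2,3)] y[of p] nonneg(2,3)[OF that(1,2)] that(1) by (cases "p \<in> S") auto
    have center: "\<exists>p\<in>S. zbar p q = 1" if "q \<in> P" for q
    proof (rule ccontr)
      assume "\<not> ?thesis"
      then have "zbar p q = 0" if "p \<in> P" for p
        using val(2)[OF that \<open>q \<in> P\<close>] y0(2)[of p q] \<open>q \<in> P\<close> that by (cases "p \<in> S") auto
      then show False using LP_feasible_sum_z[OF LP that] by simp
    qed
    have zbar_other: "zbar p' q = 0" if "p \<in> P" "p' \<in> P" "q \<in> P" "p' \<noteq> p" "zbar p q = 1" for p p' q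
    proof -
      have "(\<Sum>p'\<in>P. zbar p' q) = zbar p q + (\<Sum>p'\<in>P - {p}. zbar p' q)"
        using P(2) that(1) by (rule sum.remove)
      then have "(\<Sum>p'\<in>P - {p}. zbar p' q) = 0"
        using LP_feasible_sum_z[OF LP that(3)] that(5) by simp
      then show ?thesis
        using that P(2) LP_feasible_nonneg[OF LP _ that(3)] by (subst (asm) sum_nonneg_eq_0_iff) auto
    qed
    \<comment> \<open>For fixed \<open>q\<close>, \<open>zbar\<close> has a single entry 1, and
      \<open>z\<close> vanishes wherever \<open>zbar\<close> does. As the entries of
      \<open>z\<close> sum to 1, the remaining one is 1.\<close>
    have z: "z p q = zbar p q" if "p \<in> P" "q \<in> P" for p q
    proof (cases "zbar p q = 0")
      case False
      then have "zbar p q = 1" using val(2)[OF that] by simp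
      have "(\<Sum>p'\<in>P. z p' q) = z p q + (\<Sum>p'\<in>P - {p}. z p' q)"
        using P(2) that(1) by (rule sum.remove)
      moreover have "(\<Sum>p'\<in>P - {p}. z p' q) = 0"
        using z0 zbar_other[OF that(1) _ that(2) _ \<open>zbar p q = 1\<close>] that(2) by (intro sum.neutral) auto
      ultimately show ?thesis
        using LP_feasible_sum_z[OF F that(2)] \<open>zbar p q = 1\<close> by simp
    qed (use z0 that in auto)
    (* If a center p were not served by itself, strictness in (iv) would force alpha p < d p p = 0,
       while (iii) at the center serving p gives alpha p >= 0. *)
    have self: "zbar p p = 1" if "p \<in> S" for p
    proof (rule ccontr)
      have "p \<in> P" using that by (simp add: S)
      assume "zbar p p \<noteq> 1"
      then have "zbar p p = 0" using val(2)[of p p] \<open>p \<in> P\<close> by simp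
      then have "\<alpha> p < d p p" using \<alpha>(4) that \<open>p \<in> P\<close> by blast
      moreover obtain p' where "p' \<in> S" "zbar p' p = 1" using center[OF \<open>p \<in> P\<close>] by blast
      then have "d p' p \<le> \<alpha> p" using \<alpha>(3) \<open>p \<in> P\<close> by blast
      moreover have "d p p = 0" "0 \<le> d p' p"
        using metric P(1) \<open>p \<in> P\<close> by (auto simp: Metric_space.mdist_zero Metric_space.nonneg)
      ultimately show False by linarith
    qed
    \<comment> \<open>On \<open>S\<close>, \<open>y p \<ge> z p p = zbar p p = 1\<close>. Since
      \<open>y\<close> and \<open>ybar\<close> have the same sum \<open>k\<close>, domination forces
      equality.\<close>
    have ge: "0 \<le> y p - ybar p" if "p \<in> P" for p
    proof (cases "p \<in> S")
      case True
      then show ?thesis using nonneg(3)[OF that that] z[OF that that] self by (simp add: S)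
    qed (use y0(1)[of p p] that nonneg(1) in auto)
    have "(\<Sum>p\<in>P. y p - ybar p) = 0"
      using LP_feasible_sum_y[OF LP] LP_feasible_sum_y[OF F] by (simp add: sum_subtractf)
    then show "\<forall>p\<in>P. y p = ybar p"
      using sum_nonneg_eq_0_iff[OF P(2) ge] by auto
    show "\<forall>p\<in>P. \<forall>q\<in>P. z p q = zbar p q" using z by blast
  qed
  have conds: "(\<forall>i\<in>{1..k}. \<forall>j\<in>{1..k}. C \<alpha> (a i) = C \<alpha> (a j)) \<longleftrightarrow>
      (\<forall>p\<in>S. \<forall>p'\<in>S. C \<alpha> p = C \<alpha> p')"
    "(\<forall>i\<in>{1..k}. \<forall>q\<in>A i. d (a i) q \<le> \<alpha> q) \<longleftrightarrow> (\<forall>p\<in>S. \<forall>q\<in>P. zbar p q = 1 \<longrightarrow> d p q \<le> \<alpha> q)"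
    "(\<forall>i\<in>{1..k}. \<forall>q\<in>P - A i. \<alpha> q \<le> d (a i) q) \<longleftrightarrow> (\<forall>p\<in>S. \<forall>q\<in>P. zbar p q = 0 \<longrightarrow> \<alpha> q \<le> d p q)"
    "(\<forall>i\<in>{1..k}. \<forall>q\<in>P - A i. \<alpha> q < d (a i) q) \<longleftrightarrow> (\<forall>p\<in>S. \<forall>q\<in>P. zbar p q = 0 \<longrightarrow> \<alpha> q < d p q)"
    for \<alpha>
    by (simp add: S_def) (rule A_iff)+
  have S_eq: "\<forall>p\<in>S. C \<alpha> p = C \<alpha> (a 1)" if "\<forall>p\<in>S. \<forall>p'\<in>S. C \<alpha> p = C \<alpha> p'" for \<alpha>
    using that \<open>a 1 \<in> S\<close> by blast
  show ?thesis
    unfolding conds S_def[symmetric] C_def[symmetric]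
  proof (intro conjI iffI impI)
    show "LP_optimal P d k ybar zbar"
      if "\<exists>\<alpha>. (\<forall>p\<in>S. \<forall>p'\<in>S. C \<alpha> p = C \<alpha> p') \<and> (\<forall>p\<in>P - S. C \<alpha> p \<le> C \<alpha> (a 1)) \<and>
        (\<forall>p\<in>S. \<forall>q\<in>P. zbar p q = 1 \<longrightarrow> d p q \<le> \<alpha> q) \<and>
        (\<forall>p\<in>S. \<forall>q\<in>P. zbar p q = 0 \<longrightarrow> \<alpha> q \<le> d p q)"
      using that by (elim exE conjE) (rule opt[OF S_eq])
    show "LP_unique_optimal P d k ybar zbar"
      if "\<exists>\<alpha>. (\<forall>p\<in>S. \<forall>p'\<in>S. C \<alpha> p = C \<alpha> p') \<and> (\<forall>p\<in>P - S. C \<alpha> p < C \<alpha> (a 1)) \<and>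
        (\<forall>p\<in>S. \<forall>q\<in>P. zbar p q = 1 \<longrightarrow> d p q \<le> \<alpha> q) \<and>
        (\<forall>p\<in>S. \<forall>q\<in>P. zbar p q = 0 \<longrightarrow> \<alpha> q < d p q)"
      using that by (elim exE conjE) (rule unique[OF S_eq])
  qed (rule dual)
qed

end
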